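(* (a) Let $S_1,S_2,S_3$ be NAA. Then $[\![S_1\wedge S_2]\!]=[\![S_1]\!]\cap[\![S_2]\!]$, and $S_1\le_m S_2\wedge S_3$ iff $S_1\le_m S_2$ and $S_1\le_m S_3$. (b) The same two statements hold when $S_1,S_2,S_3$ are DMTS.
   Context: Fix a finite alphabet $\Sigma$. NAA: $(S,S^0,\mathrm{Tran})$, $S^0\subseteq S$ finite, $\mathrm{Tran}:S\to 2^{\mathcal P_{\mathrm{fin}}(\Sigma\times S)}$; NAA modal refinement $R$: for $(s_1,s_2)\in R$ and $M_1\in\mathrm{Tran}_1(s_1)$ there is $M_2\in\mathrm{Tran}_2(s_2)$ with each $(a,t_1)\in M_1$ matched by some $(a,t_2)\in M_2$ with $(t_1,t_2)\in R$ and vice versa. DMTS: $(S,S^0,\dashrightarrow,\longrightarrow)$, $S^0$ finite, image-finite may relation $\dashrightarrow\subseteq S\times\Sigma\times S$, must relation $\longrightarrow\subseteq S\times2^{\Sigma\times S}$ with $s\longrightarrow N,(a,t)\in N\Rightarrow s\overset a\dashrightarrow t$; DMTS modal refinement $R$: for $(s_1,s_2)\in R$, each $s_1\overset a\dashrightarrow t_1$ has $s_2\overset a\dashrightarrow t_2$ with $(t_1,t_2)\in R$, and each $s_2\longrightarrow N_2$ has $s_1\longrightarrow N_1$ such that each $(a,t_1)\in N_1$ has $(a,t_2)\in N_2$ with $(t_1,t_2)\in R$. Initialised: every left initial state related to some right initial state; $S_1\le_m S_2$ iff an initialised refinement exists. LTS $(I,i^0,\to)$ (image-finite) are NAA with initial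 set $\{i^0\}$ and $\mathrm{Tran}(s)=\{\{(a,t)\mid s\xrightarrow at\}\}$, resp. DMTS with may $=\to$ and must $=\{(s,\{(a,t)\})\mid s\xrightarrow at\}$; $[\![S]\!]=\{I \text{ LTS}\mid I\le_m S\}$. DMTS conjunction: $S_1\wedge S_2=(S_1\times S_2,S_1^0\times S_2^0,\dashrightarrow,\longrightarrow)$ with $(s_1,s_2)\overset a\dashrightarrow(t_1,t_2)$ iff $s_1\overset a\dashrightarrow_1t_1$ and $s_2\overset a\dashrightarrow_2t_2$; for every $s_1\longrightarrow_1N_1$, $(s_1,s_2)\longrightarrow\{(a,(t_1,t_2))\mid(a,t_1)\in N_1,(s_1,s_2)\overset a\dashrightarrow(t_1,t_2)\}$; symmetrically for every $s_2\longrightarrow_2N_2$; no other must transitions. NAA conjunction: $S_1\wedge S_2=(S_1\times S_2,S_1^0\times S_2^0,\mathrm{Tran})$, $\mathrm{Tran}((s_1,s_2))=\{M\subseteq\Sigma\times S_1\times S_2\mid\pi_1(M)\in\mathrm{Tran}_1(s_1),\pi_2(M)\in\mathrm{Tran}_2(s_2)\}$ where $\pi_1(M)=\{(a,s_1)\mid\exists s_2:(a,s_1,s_2)\in M\}$, $\pi_2(M)=\{(a,s_2)\mid\exists s_1:(a,s_1,s_2)\in M\}$. *)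

theory Defs
  imports Main
begin

record ('s, 'a) naa =
  nstates :: "'s set"
  ninit :: "'s set"
  ntran :: "'s \<Rightarrow> ('a \<times> 's) set set"

text \<open>The alphabet is a finite set \<open>\<Sigma>\<close>, passed explicitly. Values of \<^const>\<open>ntran\<close> outside the
  state set are irrelevant: refinements only relate states of the two structures.\<close>

definition is_naa :: "'a set \<Rightarrow> ('s, 'a) naa \<Rightarrow> bool" where
  "is_naa \<Sigma> A \<longleftrightarrow>
     ninit A \<subseteq> nstates A \<and> finite (ninit A) \<and>
     (\<forall>s\<in>nstates A. \<forall>M\<in>ntran A s. finite M \<and> M \<subseteq> \<Sigma> \<times> nstates A)"

definition naa_refinement :: "('s, 'a) naa \<Rightarrow> ('t, 'a) naa \<Rightarrow> ('s \<times> 't) set \<Rightarrow> bool" where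
  "naa_refinement A B R \<longleftrightarrow>
     R \<subseteq> nstates A \<times> nstates B \<and>
     (\<forall>(s1, s2)\<in>R. \<forall>M1\<in>ntran A s1. \<exists>M2\<in>ntran B s2.
        (\<forall>(a, t1)\<in>M1. \<exists>t2. (a, t2) \<in> M2 \<and> (t1, t2) \<in> R) \<and>
        (\<forall>(a, t2)\<in>M2. \<exists>t1. (a, t1) \<in> M1 \<and> (t1, t2) \<in> R))"

definition initialised :: "'s set \<Rightarrow> 't set \<Rightarrow> ('s \<times> 't) set \<Rightarrow> bool" where
  "initialised I J R \<longleftrightarrow> (\<forall>s1\<in>I. \<exists>s2\<in>J. (s1, s2) \<in> R)"

definition naa_le :: "('s, 'a) naa \<Rightarrow> ('t, 'a) naa \<Rightarrow> bool" where
  "naa_le A B \<longleftrightarrow> (\<exists>R. naa_refinement A B R \<and> initialised (ninit A) (ninit B) R)"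

record ('s, 'a) dmts =
  dstates :: "'s set"
  dinit :: "'s set"
  dmay :: "('s \<times> 'a \<times> 's) set"
  dmust :: "('s \<times> ('a \<times> 's) set) set"

definition is_dmts :: "'a set \<Rightarrow> ('s, 'a) dmts \<Rightarrow> bool" where
  "is_dmts \<Sigma> D \<longleftrightarrow>
     dinit D \<subseteq> dstates D \<and> finite (dinit D) \<and>
     dmay D \<subseteq> dstates D \<times> \<Sigma> \<times> dstates D \<and>
     (\<forall>s a. finite {t. (s, a, t) \<in> dmay D}) \<and>
     dmust D \<subseteq> dstates D \<times> Pow (\<Sigma> \<times> dstates D) \<and>
     (\<forall>(s, N)\<in>dmust D. \<forall>(a, t)\<in>N. (s, a, t) \<in> dmay D)"

definition dmts_refinement :: "('s, 'a) dmts \<Rightarrow> ('t, 'a) dmts \<Rightarrow> ('s \<times> 't) set \<Rightarrow> bool" where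
  "dmts_refinement D E R \<longleftrightarrow>
     R \<subseteq> dstates D \<times> dstates E \<and>
     (\<forall>(s1, s2)\<in>R.
        (\<forall>a t1. (s1, a, t1) \<in> dmay D \<longrightarrow> (\<exists>t2. (s2, a, t2) \<in> dmay E \<and> (t1, t2) \<in> R)) \<and>
        (\<forall>N2. (s2, N2) \<in> dmust E \<longrightarrow>
           (\<exists>N1. (s1, N1) \<in> dmust D \<and>
              (\<forall>(a, t1)\<in>N1. \<exists>t2. (a, t2) \<in> N2 \<and> (t1, t2) \<in> R))))"

definition dmts_le :: "('s, 'a) dmts \<Rightarrow> ('t, 'a) dmts \<Rightarrow> bool" where
  "dmts_le D E \<longleftrightarrow> (\<exists>R. dmts_refinement D E R \<and> initialised (dinit D) (dinit E) R)"

record ('i, 'a) lts =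
  lstates :: "'i set"
  linit :: "'i"
  ltrans :: "('i \<times> 'a \<times> 'i) set"

definition is_lts :: "'a set \<Rightarrow> ('i, 'a) lts \<Rightarrow> bool" where
  "is_lts \<Sigma> I \<longleftrightarrow>
     linit I \<in> lstates I \<and>
     ltrans I \<subseteq> lstates I \<times> \<Sigma> \<times> lstates I \<and>
     (\<forall>s a. finite {t. (s, a, t) \<in> ltrans I})"

definition lts_naa :: "('i, 'a) lts \<Rightarrow> ('i, 'a) naa" where
  "lts_naa I = \<lparr> nstates = lstates I, ninit = {linit I},
     ntran = (\<lambda>s. {{(a, t). (s, a, t) \<in> ltrans I}}) \<rparr>"

definition lts_dmts :: "('i, 'a) lts \<Rightarrow> ('i, 'a) dmts" where
  "lts_dmts I = \<lparr> dstates = lstates I, dinit = {linit I}, dmay = ltrans I,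
     dmust = {(s, {(a, t)}) | s a t. (s, a, t) \<in> ltrans I} \<rparr>"

text \<open>The type \<open>'i\<close> from which implementations draw their states is a parameter, since the
  collection of all LTS over arbitrary state types is not a HOL set.\<close>

definition naa_sem :: "'a set \<Rightarrow> ('s, 'a) naa \<Rightarrow> ('i, 'a) lts set" where
  "naa_sem \<Sigma> A = {I. is_lts \<Sigma> I \<and> naa_le (lts_naa I) A}"

definition dmts_sem :: "'a set \<Rightarrow> ('s, 'a) dmts \<Rightarrow> ('i, 'a) lts set" where
  "dmts_sem \<Sigma> D = {I. is_lts \<Sigma> I \<and> dmts_le (lts_dmts I) D}"

definition proj1 :: "('a \<times> 's \<times> 't) set \<Rightarrow> ('a \<times> 's) set" where
  "proj1 M = {(a, s1). \<exists>s2. (a, s1, s2) \<in> M}"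

definition proj2 :: "('a \<times> 's \<times> 't) set \<Rightarrow> ('a \<times> 't) set" where
  "proj2 M = {(a, s2). \<exists>s1. (a, s1, s2) \<in> M}"

definition naa_conj :: "'a set \<Rightarrow> ('s, 'a) naa \<Rightarrow> ('t, 'a) naa \<Rightarrow> ('s \<times> 't, 'a) naa" where
  "naa_conj \<Sigma> A B = \<lparr> nstates = nstates A \<times> nstates B, ninit = ninit A \<times> ninit B,
     ntran = (\<lambda>(s1, s2). {M. M \<subseteq> \<Sigma> \<times> nstates A \<times> nstates B \<and>
                proj1 M \<in> ntran A s1 \<and> proj2 M \<in> ntran B s2}) \<rparr>"

definition conj_may :: "('s, 'a) dmts \<Rightarrow> ('t, 'a) dmts \<Rightarrow> (('s \<times> 't) \<times> 'a \<times> ('s \<times> 't)) set" where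
  "conj_may D E = {((s1, s2), a, (t1, t2)) | s1 s2 a t1 t2.
     (s1, a, t1) \<in> dmay D \<and> (s2, a, t2) \<in> dmay E}"

definition dmts_conj :: "('s, 'a) dmts \<Rightarrow> ('t, 'a) dmts \<Rightarrow> ('s \<times> 't, 'a) dmts" where
  "dmts_conj D E = \<lparr> dstates = dstates D \<times> dstates E, dinit = dinit D \<times> dinit E,
     dmay = conj_may D E,
     dmust =
       {((s1, s2), {(a, (t1, t2)). (a, t1) \<in> N1 \<and> ((s1, s2), a, (t1, t2)) \<in> conj_may D E})
         | s1 s2 N1. (s1, N1) \<in> dmust D \<and> s2 \<in> dstates E} \<union>
       {((s1, s2), {(a, (t1, t2)). (a, t2) \<in> N2 \<and> ((s1, s2), a, (t1, t2)) \<in> conj_may D E})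
         | s1 s2 N2. s1 \<in> dstates D \<and> (s2, N2) \<in> dmust E} \<rparr>"

lemma is_naa_lts_naa:
  assumes "finite \<Sigma>" and I: "is_lts \<Sigma> I"
  shows "is_naa \<Sigma> (lts_naa I)"
proof -
  have "finite {(a, t). (s, a, t) \<in> ltrans I}" for s
  proof (rule finite_subset)
    show "{(a, t). (s, a, t) \<in> ltrans I} \<subseteq> (SIGMA a:\<Sigma>. {t. (s, a, t) \<in> ltrans I})"
      using I by (auto simp: is_lts_def)
    show "finite (SIGMA a:\<Sigma>. {t. (s, a, t) \<in> ltrans I})"
      using assms by (auto simp: is_lts_def)
  qed
  then show ?thesis
    using I by (auto simp: is_lts_def is_naa_def lts_naa_def)
qed

lemma is_dmts_lts_dmts:
  assumes "is_lts \<Sigma> I"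
  shows "is_dmts \<Sigma> (lts_dmts I)"
  using assms by (fastforce simp: is_lts_def is_dmts_def lts_dmts_def)

lemma is_naa_naa_conj:
  assumes A: "is_naa \<Sigma> A" and B: "is_naa \<Sigma> B"
  shows "is_naa \<Sigma> (naa_conj \<Sigma> A B)"
proof -
  have "finite M" if "s1 \<in> nstates A" "s2 \<in> nstates B"
    "proj1 M \<in> ntran A s1" "proj2 M \<in> ntran B s2" for M s1 s2
  proof (rule finite_subset)
    show "M \<subseteq> (\<lambda>((a, t1), (b, t2)). (a, t1, t2)) ` (proj1 M \<times> proj2 M)"
    proof
      fix x assume "x \<in> M"
      moreover obtain a t1 t2 where "x = (a, t1, t2)" by (cases x)
      ultimately show "x \<in> (\<lambda>((a, t1), (b, t2)). (a, t1, t2)) ` (proj1 M \<times> proj2 M)"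
        by (intro image_eqI[of _ _ "((a, t1), (a, t2))"]) (auto simp: proj1_def proj2_def)
    qed
    show "finite ((\<lambda>((a, t1), (b, t2)). (a, t1, t2)) ` (proj1 M \<times> proj2 M))"
      using A B that by (auto simp: is_naa_def)
  qed
  then show ?thesis
    using A B by (auto simp: is_naa_def naa_conj_def)
qed

lemma is_dmts_dmts_conj:
  assumes D: "is_dmts \<Sigma> D" and E: "is_dmts \<Sigma> E"
  shows "is_dmts \<Sigma> (dmts_conj D E)"
proof -
  have sub: "conj_may D E \<subseteq> (dstates D \<times> dstates E) \<times> \<Sigma> \<times> (dstates D \<times> dstates E)"
    using D E by (auto simp: is_dmts_def conj_may_def)
  have fin: "finite {t. (s, a, t) \<in> conj_may D E}" for s a
  proof (rule finite_subset)
    show "{t. (s, a, t) \<in> conj_may D E} \<subseteq>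
        {t. (fst s, a, t) \<in> dmay D} \<times> {t. (snd s, a, t) \<in> dmay E}"
      by (auto simp: conj_may_def)
    show "finite ({t. (fst s, a, t) \<in> dmay D} \<times> {t. (snd s, a, t) \<in> dmay E})"
      using D E by (auto simp: is_dmts_def)
  qed
  have must: "s \<in> dstates D \<times> dstates E \<and> (\<forall>(a, t)\<in>N. (s, a, t) \<in> conj_may D E)"
    if "(s, N) \<in> dmust (dmts_conj D E)" for s N
  proof -
    have "dmust D \<subseteq> dstates D \<times> UNIV" "dmust E \<subseteq> dstates E \<times> UNIV"
      using D E by (auto simp: is_dmts_def)
    with that show ?thesis by (auto simp: dmts_conj_def)
  qed
  have "dmust (dmts_conj D E) \<subseteq>
      (dstates D \<times> dstates E) \<times> Pow (\<Sigma> \<times> (dstates D \<times> dstates E))"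
  proof (rule subrelI)
    fix s N assume "(s, N) \<in> dmust (dmts_conj D E)"
    note * = must[OF this]
    have "x \<in> \<Sigma> \<times> (dstates D \<times> dstates E)" if "x \<in> N" for x
    proof -
      obtain a t where x: "x = (a, t)" by (cases x)
      have "(s, a, t) \<in> conj_may D E" using * that x by auto
      then have "(s, a, t) \<in> (dstates D \<times> dstates E) \<times> \<Sigma> \<times> (dstates D \<times> dstates E)"
        by (rule subsetD[OF sub])
      then show ?thesis using x by simp
    qed
    with * show "(s, N) \<in> (dstates D \<times> dstates E) \<times> Pow (\<Sigma> \<times> (dstates D \<times> dstates E))"
      by (intro SigmaI PowI subsetI) auto
  qed
  moreover have "\<forall>(s, N)\<in>dmust (dmts_conj D E). \<forall>(a, t)\<in>N. (s, a, t) \<in> conj_may D E"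
  proof (intro ballI, clarify)
    fix s1 s2 N a t1 t2
    assume "((s1, s2), N) \<in> dmust (dmts_conj D E)" "(a, t1, t2) \<in> N"
    then show "((s1, s2), a, t1, t2) \<in> conj_may D E"
      using must[of "(s1, s2)" N] by auto
  qed
  moreover have "dinit D \<times> dinit E \<subseteq> dstates D \<times> dstates E" "finite (dinit D \<times> dinit E)"
    using D E by (auto simp: is_dmts_def)
  moreover have "dstates (dmts_conj D E) = dstates D \<times> dstates E"
    "dinit (dmts_conj D E) = dinit D \<times> dinit E" "dmay (dmts_conj D E) = conj_may D E"
    by (simp_all add: dmts_conj_def)
  ultimately show ?thesis
    unfolding is_dmts_def using sub fin by presburger
qed

end

theory Submission
  imports Defs
begin

text \<open>A refinement \<open>R\<close> into a conjunction projects to refinements into both conjuncts. Conversely,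
  refinements \<open>R\<close> and \<open>Q\<close> into the conjuncts combine to
  \<open>{(s, (t, u)). (s, t) \<in> R \<and> (s, u) \<in> Q}\<close>: for NAA, choices \<open>M2\<close> and \<open>M3\<close> matching the same \<open>M1\<close>
  are glued along the elements of \<open>M1\<close> that justify them; for DMTS, the target missing on the other
  side of a must transition is supplied by the may transition that underlies every must transition
  of the refining system.\<close>

section \<open>Conjunction of NAA as greatest lower bound for modal refinement\<close>

lemma naa_refinementE:
  assumes "naa_refinement A B R" "(s, t) \<in> R" "M1 \<in> ntran A s"
  obtains M2 where "M2 \<in> ntran B t"
    "\<And>a s'. (a, s') \<in> M1 \<Longrightarrow> \<exists>t'. (a, t') \<in> M2 \<and> (s', t') \<in> R"
    "\<And>a t'. (a, t') \<in> M2 \<Longrightarrow> \<exists>s'. (a, s') \<in> M1 \<and> (s', t') \<in> R"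
proof -
  have "\<forall>(s, t)\<in>R. \<forall>M1\<in>ntran A s. \<exists>M2\<in>ntran B t.
      (\<forall>(a, s')\<in>M1. \<exists>t'. (a, t') \<in> M2 \<and> (s', t') \<in> R) \<and>
      (\<forall>(a, t')\<in>M2. \<exists>s'. (a, s') \<in> M1 \<and> (s', t') \<in> R)"
    using assms(1) by (simp add: naa_refinement_def)
  from bspec[OF this assms(2), simplified, THEN bspec, OF assms(3)]
  show thesis using that by fast
qed

text \<open>Forgetting the second component of right-hand states turns a refinement \<open>R\<close>
  into \<open>Q\<close>. If \<open>M\<close> answers \<open>M1\<close> in the conjunction, then
  \<open>proj1 M\<close> is admissible in \<open>B\<close> by the very definition of
  \<open>naa_conj\<close>, and each match through \<open>R\<close> becomes one through
  \<open>Q\<close>, whatever second component it carried.\<close>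

lemma naa_le_conjD1:
  assumes "naa_le A (naa_conj \<Sigma> B C)"
  shows "naa_le A B"
proof -
  obtain R where R: "naa_refinement A (naa_conj \<Sigma> B C) R"
    and init: "initialised (ninit A) (ninit B \<times> ninit C) R"
    using assms by (auto simp: naa_le_def naa_conj_def)
  define Q where "Q = {(s, t). \<exists>u. (s, (t, u)) \<in> R}"
  have "\<exists>M2\<in>ntran B t.
      (\<forall>(a, s')\<in>M1. \<exists>t'. (a, t') \<in> M2 \<and> (s', t') \<in> Q) \<and>
      (\<forall>(a, t')\<in>M2. \<exists>s'. (a, s') \<in> M1 \<and> (s', t') \<in> Q)"
    if s: "(s, t) \<in> Q" and "M1 \<in> ntran A s" for s t M1
  proof -
    obtain u where "(s, (t, u)) \<in> R" using s by (auto simp: Q_def)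
    then obtain M where M: "M \<in> ntran (naa_conj \<Sigma> B C) (t, u)"
      "\<And>a s'. (a, s') \<in> M1 \<Longrightarrow> \<exists>x. (a, x) \<in> M \<and> (s', x) \<in> R"
      "\<And>a x. (a, x) \<in> M \<Longrightarrow> \<exists>s'. (a, s') \<in> M1 \<and> (s', x) \<in> R"
      using naa_refinementE[OF R _ \<open>M1 \<in> ntran A s\<close>] by blast
    show ?thesis
    proof (intro bexI[of _ "proj1 M"] conjI)
      show "\<forall>(a, s')\<in>M1. \<exists>t'. (a, t') \<in> proj1 M \<and> (s', t') \<in> Q"
        using M(2) by (fastforce simp: proj1_def Q_def)
      show "\<forall>(a, t')\<in>proj1 M. \<exists>s'. (a, s') \<in> M1 \<and> (s', t') \<in> Q"
        using M(3) by (fastforce simp: proj1_def Q_def)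
      show "proj1 M \<in> ntran B t" using M(1) by (simp add: naa_conj_def)
    qed
  qed
  moreover have "Q \<subseteq> nstates A \<times> nstates B"
    using R by (auto simp: naa_refinement_def naa_conj_def Q_def)
  ultimately have "naa_refinement A B Q"
    by (auto simp: naa_refinement_def)
  moreover have "initialised (ninit A) (ninit B) Q"
    using init by (fastforce simp: initialised_def Q_def)
  ultimately show ?thesis by (auto simp: naa_le_def)
qed

text \<open>Mirror image of \<open>naa_le_conjD1\<close>: here the first component is forgotten and
  \<open>proj2 M\<close> is the answer to \<open>M1\<close>.\<close>

lemma naa_le_conjD2:
  assumes "naa_le A (naa_conj \<Sigma> B C)"
  shows "naa_le A C"
proof -
  obtain R where R: "naa_refinement A (naa_conj \<Sigma> B C) R"
    and init: "initialised (ninit A) (ninit B \<times> ninit C) R"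
    using assms by (auto simp: naa_le_def naa_conj_def)
  define Q where "Q = {(s, u). \<exists>t. (s, (t, u)) \<in> R}"
  have "\<exists>M2\<in>ntran C u.
      (\<forall>(a, s')\<in>M1. \<exists>u'. (a, u') \<in> M2 \<and> (s', u') \<in> Q) \<and>
      (\<forall>(a, u')\<in>M2. \<exists>s'. (a, s') \<in> M1 \<and> (s', u') \<in> Q)"
    if s: "(s, u) \<in> Q" and "M1 \<in> ntran A s" for s u M1
  proof -
    obtain t where "(s, (t, u)) \<in> R" using s by (auto simp: Q_def)
    then obtain M where M: "M \<in> ntran (naa_conj \<Sigma> B C) (t, u)"
      "\<And>a s'. (a, s') \<in> M1 \<Longrightarrow> \<exists>x. (a, x) \<in> M \<and> (s', x) \<in> R"
      "\<And>a x. (a, x) \<in> M \<Longrightarrow> \<exists>s'. (a, s') \<in> M1 \<and> (s', x) \<in> R"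
      using naa_refinementE[OF R _ \<open>M1 \<in> ntran A s\<close>] by blast
    show ?thesis
    proof (intro bexI[of _ "proj2 M"] conjI)
      show "\<forall>(a, s')\<in>M1. \<exists>u'. (a, u') \<in> proj2 M \<and> (s', u') \<in> Q"
        using M(2) by (fastforce simp: proj2_def Q_def)
      show "\<forall>(a, u')\<in>proj2 M. \<exists>s'. (a, s') \<in> M1 \<and> (s', u') \<in> Q"
        using M(3) by (fastforce simp: proj2_def Q_def)
      show "proj2 M \<in> ntran C u" using M(1) by (simp add: naa_conj_def)
    qed
  qed
  moreover have "Q \<subseteq> nstates A \<times> nstates C"
    using R by (auto simp: naa_refinement_def naa_conj_def Q_def)
  ultimately have "naa_refinement A C Q"
    by (auto simp: naa_refinement_def)
  moreover have "initialised (ninit A) (ninit C) Q"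
    using init by (fastforce simp: initialised_def Q_def)
  ultimately show ?thesis by (auto simp: naa_le_def)
qed

lemma naa_le_conjI:
  assumes B: "is_naa \<Sigma> B" and C: "is_naa \<Sigma> C"
    and "naa_le A B" "naa_le A C"
  shows "naa_le A (naa_conj \<Sigma> B C)"
proof -
  obtain R where R: "naa_refinement A B R" and R_init: "initialised (ninit A) (ninit B) R"
    using assms by (auto simp: naa_le_def)
  obtain Q where Q: "naa_refinement A C Q" and Q_init: "initialised (ninit A) (ninit C) Q"
    using assms by (auto simp: naa_le_def)
  define P where "P = {(s, (t, u)). (s, t) \<in> R \<and> (s, u) \<in> Q}"
  have "\<exists>M\<in>ntran (naa_conj \<Sigma> B C) (t, u).
      (\<forall>(a, s')\<in>M1. \<exists>x. (a, x) \<in> M \<and> (s', x) \<in> P) \<and>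
      (\<forall>(a, x)\<in>M. \<exists>s'. (a, s') \<in> M1 \<and> (s', x) \<in> P)"
    if s: "(s, t) \<in> R" "(s, u) \<in> Q" and M1: "M1 \<in> ntran A s" for s t u M1
  proof -
    obtain M2 where M2: "M2 \<in> ntran B t"
      "\<And>a s'. (a, s') \<in> M1 \<Longrightarrow> \<exists>t'. (a, t') \<in> M2 \<and> (s', t') \<in> R"
      "\<And>a t'. (a, t') \<in> M2 \<Longrightarrow> \<exists>s'. (a, s') \<in> M1 \<and> (s', t') \<in> R"
      using naa_refinementE[OF R s(1) M1] by blast
    obtain M3 where M3: "M3 \<in> ntran C u"
      "\<And>a s'. (a, s') \<in> M1 \<Longrightarrow> \<exists>u'. (a, u') \<in> M3 \<and> (s', u') \<in> Q"
      "\<And>a u'. (a, u') \<in> M3 \<Longrightarrow> \<exists>s'. (a, s') \<in> M1 \<and> (s', u') \<in> Q"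
      using naa_refinementE[OF Q s(2) M1] by blast
    \<comment> \<open>A pair enters \<open>M\<close> only if one common \<open>s'\<close> justifies
      both halves. This makes the backward matching through \<open>P\<close> immediate; pairing all
      equally labelled elements of \<open>M2\<close> and \<open>M3\<close> could yield pairs that no
      single \<open>s'\<close> refines.\<close>
    define M where "M = {(a, (t', u')). (a, t') \<in> M2 \<and> (a, u') \<in> M3 \<and>
      (\<exists>s'. (a, s') \<in> M1 \<and> (s', t') \<in> R \<and> (s', u') \<in> Q)}"
    \<comment> \<open>No element of \<open>M2\<close> is lost: it is justified by some
      \<open>s'\<close> in \<open>M1\<close>, and the forward matching of \<open>M1\<close> into
      \<open>M3\<close> gives that same \<open>s'\<close> a partner \<open>u'\<close>. The second
      projection is dual.\<close>
    have "proj1 M = M2" using M2(3) M3(2) by (fastforce simp: proj1_def M_def)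
    moreover have "proj2 M = M3" using M3(3) M2(2) by (fastforce simp: proj2_def M_def)
    moreover have "M \<subseteq> \<Sigma> \<times> nstates B \<times> nstates C"
    proof -
      have "t \<in> nstates B" "u \<in> nstates C"
        using R Q s by (auto simp: naa_refinement_def)
      then have "M2 \<subseteq> \<Sigma> \<times> nstates B" "M3 \<subseteq> \<Sigma> \<times> nstates C"
        using B C M2(1) M3(1) by (auto simp: is_naa_def)
      then show ?thesis by (auto simp: M_def)
    qed
    ultimately have "M \<in> ntran (naa_conj \<Sigma> B C) (t, u)"
      using M2(1) M3(1) by (simp add: naa_conj_def)
    moreover have "\<exists>x. (a, x) \<in> M \<and> (s', x) \<in> P" if "(a, s') \<in> M1" for a s'
      using M2(2)[OF that] M3(2)[OF that] that by (auto simp: M_def P_def)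
    moreover have "\<forall>(a, x)\<in>M. \<exists>s'. (a, s') \<in> M1 \<and> (s', x) \<in> P"
      by (auto simp: M_def P_def)
    ultimately show ?thesis by blast
  qed
  moreover have "P \<subseteq> nstates A \<times> nstates (naa_conj \<Sigma> B C)"
    using R Q by (auto simp: naa_refinement_def naa_conj_def P_def)
  ultimately have "naa_refinement A (naa_conj \<Sigma> B C) P"
    unfolding naa_refinement_def by (auto simp: P_def)
  moreover have "initialised (ninit A) (ninit (naa_conj \<Sigma> B C)) P"
    using R_init Q_init by (fastforce simp: initialised_def naa_conj_def P_def)
  ultimately show ?thesis by (auto simp: naa_le_def)
qed

text \<open>The left-hand side \<open>A\<close> is left general so that both an NAA and the
  embedding of an LTS can be substituted for it.\<close>

lemma naa_le_conj_iff:
  assumes "is_naa \<Sigma> B" "is_naa \<Sigma> C"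
  shows "naa_le A (naa_conj \<Sigma> B C) \<longleftrightarrow> naa_le A B \<and> naa_le A C"
  using naa_le_conjD1 naa_le_conjD2 naa_le_conjI[OF assms] by blast

section \<open>Conjunction of DMTS as greatest lower bound for modal refinement\<close>

lemma dmts_conj_simps [simp]:
  "dstates (dmts_conj D E) = dstates D \<times> dstates E"
  "dinit (dmts_conj D E) = dinit D \<times> dinit E"
  "((s, t), a, (s', t')) \<in> dmay (dmts_conj D E) \<longleftrightarrow> (s, a, s') \<in> dmay D \<and> (t, a, t') \<in> dmay E"
  by (auto simp: dmts_conj_def conj_may_def)

text \<open>Splits the must transitions of a conjunction by the conjunct they originate from, giving
  the case distinction used in \<open>dmts_le_conjI\<close>.\<close>

lemma dmust_dmts_conj_iff:
  "((s, t), N) \<in> dmust (dmts_conj D E) \<longleftrightarrow>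
     (\<exists>N1. (s, N1) \<in> dmust D \<and> t \<in> dstates E \<and>
        N = {(a, (s', t')). (a, s') \<in> N1 \<and> (s, a, s') \<in> dmay D \<and> (t, a, t') \<in> dmay E}) \<or>
     (\<exists>N2. s \<in> dstates D \<and> (t, N2) \<in> dmust E \<and>
        N = {(a, (s', t')). (a, t') \<in> N2 \<and> (s, a, s') \<in> dmay D \<and> (t, a, t') \<in> dmay E})"
  by (simp add: dmts_conj_def conj_may_def) blast

text \<open>May transitions project directly. A must transition of \<open>E\<close> is first lifted
  to the conjunction, answered there through \<open>R\<close>, and the matching targets are then
  projected back to \<open>E\<close>.\<close>

lemma dmts_le_conjD1:
  assumes "dmts_le D (dmts_conj E F)"
  shows "dmts_le D E"
proof -
  obtain R where R: "dmts_refinement D (dmts_conj E F) R"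
    and init: "initialised (dinit D) (dinit E \<times> dinit F) R"
    using assms by (auto simp: dmts_le_def)
  define Q where "Q = {(s, t). \<exists>u. (s, (t, u)) \<in> R}"
  have "\<exists>t'. (t, a, t') \<in> dmay E \<and> (s', t') \<in> Q"
    if "(s, t) \<in> Q" "(s, a, s') \<in> dmay D" for s t a s'
    using R that by (fastforce simp: dmts_refinement_def Q_def)
  moreover have "\<exists>N1. (s, N1) \<in> dmust D \<and> (\<forall>(a, s')\<in>N1. \<exists>t'. (a, t') \<in> N2 \<and> (s', t') \<in> Q)"
    if s: "(s, t) \<in> Q" and N2: "(t, N2) \<in> dmust E" for s t N2
  proof -
    obtain u where u: "(s, (t, u)) \<in> R" using s by (auto simp: Q_def)
    \<comment> \<open>The conjunction lifts a must transition of \<open>E\<close> only to pairs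
      whose second component is a state of \<open>F\<close>.\<close>
    then have "u \<in> dstates F" using R by (auto simp: dmts_refinement_def)
    define N where "N = {(a, (t', u')). (a, t') \<in> N2 \<and> (t, a, t') \<in> dmay E \<and> (u, a, u') \<in> dmay F}"
    have "((t, u), N) \<in> dmust (dmts_conj E F)"
      using N2 \<open>u \<in> dstates F\<close> by (auto simp: dmust_dmts_conj_iff N_def)
    then obtain N1 where "(s, N1) \<in> dmust D" "\<forall>(a, s')\<in>N1. \<exists>x. (a, x) \<in> N \<and> (s', x) \<in> R"
      using R u unfolding dmts_refinement_def by blast
    then show ?thesis by (intro exI[of _ N1]) (fastforce simp: N_def Q_def)
  qed
  moreover have "Q \<subseteq> dstates D \<times> dstates E"
    using R by (auto simp: dmts_refinement_def Q_def)
  ultimately have "dmts_refinement D E Q"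
    by (auto simp: dmts_refinement_def)
  moreover have "initialised (dinit D) (dinit E) Q"
    using init by (fastforce simp: initialised_def Q_def)
  ultimately show ?thesis by (auto simp: dmts_le_def)
qed

text \<open>Symmetric to \<open>dmts_le_conjD1\<close>, lifting must transitions of \<open>F\<close>
  instead.\<close>

lemma dmts_le_conjD2:
  assumes "dmts_le D (dmts_conj E F)"
  shows "dmts_le D F"
proof -
  obtain R where R: "dmts_refinement D (dmts_conj E F) R"
    and init: "initialised (dinit D) (dinit E \<times> dinit F) R"
    using assms by (auto simp: dmts_le_def)
  define Q where "Q = {(s, u). \<exists>t. (s, (t, u)) \<in> R}"
  have "\<exists>u'. (u, a, u') \<in> dmay F \<and> (s', u') \<in> Q"
    if "(s, u) \<in> Q" "(s, a, s') \<in> dmay D" for s u a s'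
    using R that by (fastforce simp: dmts_refinement_def Q_def)
  moreover have "\<exists>N1. (s, N1) \<in> dmust D \<and> (\<forall>(a, s')\<in>N1. \<exists>u'. (a, u') \<in> N2 \<and> (s', u') \<in> Q)"
    if s: "(s, u) \<in> Q" and N2: "(u, N2) \<in> dmust F" for s u N2
  proof -
    obtain t where t: "(s, (t, u)) \<in> R" using s by (auto simp: Q_def)
    then have "t \<in> dstates E" using R by (auto simp: dmts_refinement_def)
    define N where "N = {(a, (t', u')). (a, u') \<in> N2 \<and> (t, a, t') \<in> dmay E \<and> (u, a, u') \<in> dmay F}"
    have "((t, u), N) \<in> dmust (dmts_conj E F)"
      using N2 \<open>t \<in> dstates E\<close> by (auto simp: dmust_dmts_conj_iff N_def)
    then obtain N1 where "(s, N1) \<in> dmust D" "\<forall>(a, s')\<in>N1. \<exists>x. (a, x) \<in> N \<and> (s', x) \<in> R"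
      using R t unfolding dmts_refinement_def by blast
    then show ?thesis by (intro exI[of _ N1]) (fastforce simp: N_def Q_def)
  qed
  moreover have "Q \<subseteq> dstates D \<times> dstates F"
    using R by (auto simp: dmts_refinement_def Q_def)
  ultimately have "dmts_refinement D F Q"
    by (auto simp: dmts_refinement_def)
  moreover have "initialised (dinit D) (dinit F) Q"
    using init by (fastforce simp: initialised_def Q_def)
  ultimately show ?thesis by (auto simp: dmts_le_def)
qed

lemma is_dmts_must_imp_may:
  assumes "is_dmts \<Sigma> D" "(s, N) \<in> dmust D" "(a, t) \<in> N"
  shows "(s, a, t) \<in> dmay D"
  using assms unfolding is_dmts_def by blast

lemma dmts_le_conjI:
  assumes D: "is_dmts \<Sigma> D" and E: "is_dmts \<Sigma> E" and F: "is_dmts \<Sigma> F"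
    and "dmts_le D E" "dmts_le D F"
  shows "dmts_le D (dmts_conj E F)"
proof -
  obtain R where R: "dmts_refinement D E R" and R_init: "initialised (dinit D) (dinit E) R"
    using assms by (auto simp: dmts_le_def)
  obtain Q where Q: "dmts_refinement D F Q" and Q_init: "initialised (dinit D) (dinit F) Q"
    using assms by (auto simp: dmts_le_def)
  have R_may: "\<exists>t'. (t, a, t') \<in> dmay E \<and> (s', t') \<in> R"
    if "(s, t) \<in> R" "(s, a, s') \<in> dmay D" for s t a s'
    using R that unfolding dmts_refinement_def by blast
  have Q_may: "\<exists>u'. (u, a, u') \<in> dmay F \<and> (s', u') \<in> Q"
    if "(s, u) \<in> Q" "(s, a, s') \<in> dmay D" for s u a s'
    using Q that unfolding dmts_refinement_def by blast
  define P where "P = {(s, (t, u)). (s, t) \<in> R \<and> (s, u) \<in> Q}"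
  have "\<exists>x. ((t, u), a, x) \<in> dmay (dmts_conj E F) \<and> (s', x) \<in> P"
    if "(s, t) \<in> R" "(s, u) \<in> Q" "(s, a, s') \<in> dmay D" for s t u a s'
    \<comment> \<open>Both answers carry the label \<open>a\<close> and are related to the same
      \<open>s'\<close>, so they pair up to a may transition of the conjunction.\<close>
    using R_may[OF that(1,3)] Q_may[OF that(2,3)] by (auto simp: P_def)
  moreover have "\<exists>N1. (s, N1) \<in> dmust D \<and> (\<forall>(a, s')\<in>N1. \<exists>x. (a, x) \<in> N \<and> (s', x) \<in> P)"
    if s: "(s, t) \<in> R" "(s, u) \<in> Q" and N: "((t, u), N) \<in> dmust (dmts_conj E F)" for s t u N
    using N unfolding dmust_dmts_conj_iff
  proof (elim disjE exE conjE)
    fix N2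
    assume N2: "(t, N2) \<in> dmust E"
      and N_eq: "N = {(a, (t', u')). (a, t') \<in> N2 \<and> (t, a, t') \<in> dmay E \<and> (u, a, u') \<in> dmay F}"
    obtain N1 where N1: "(s, N1) \<in> dmust D"
      and match: "\<forall>(a, s')\<in>N1. \<exists>t'. (a, t') \<in> N2 \<and> (s', t') \<in> R"
      using R s N2 unfolding dmts_refinement_def by blast
    have "\<exists>x. (a, x) \<in> N \<and> (s', x) \<in> P" if as: "(a, s') \<in> N1" for a s'
    proof -
      obtain t' where "(a, t') \<in> N2" "(s', t') \<in> R" using match as by auto
      \<comment> \<open>The must clause of \<open>R\<close> says nothing about \<open>F\<close>. But
        \<open>(a, s')\<close> lies in a must transition of \<open>D\<close>, hence is a may
        transition of \<open>D\<close>, and the may clause of \<open>Q\<close> yields the missing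
        \<open>u'\<close>.\<close>
      moreover obtain u' where "(u, a, u') \<in> dmay F" "(s', u') \<in> Q"
        using Q_may[OF s(2)] is_dmts_must_imp_may[OF D N1 as] by blast
      \<comment> \<open>Membership in \<open>N\<close> also asks for a may transition in
        \<open>E\<close>; it underlies the must transition \<open>N2\<close>.\<close>
      moreover have "(t, a, t') \<in> dmay E"
        using is_dmts_must_imp_may[OF E N2] \<open>(a, t') \<in> N2\<close> .
      ultimately show ?thesis by (auto simp: N_eq P_def)
    qed
    then show ?thesis using N1 by auto
  next
    fix N2
    assume N2: "(u, N2) \<in> dmust F"
      and N_eq: "N = {(a, (t', u')). (a, u') \<in> N2 \<and> (t, a, t') \<in> dmay E \<and> (u, a, u') \<in> dmay F}"
    obtain N1 where N1: "(s, N1) \<in> dmust D"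
      and match: "\<forall>(a, s')\<in>N1. \<exists>u'. (a, u') \<in> N2 \<and> (s', u') \<in> Q"
      using Q s N2 unfolding dmts_refinement_def by blast
    have "\<exists>x. (a, x) \<in> N \<and> (s', x) \<in> P" if as: "(a, s') \<in> N1" for a s'
    proof -
      obtain u' where "(a, u') \<in> N2" "(s', u') \<in> Q" using match as by auto
      moreover obtain t' where "(t, a, t') \<in> dmay E" "(s', t') \<in> R"
        using R_may[OF s(1)] is_dmts_must_imp_may[OF D N1 as] by blast
      moreover have "(u, a, u') \<in> dmay F"
        using is_dmts_must_imp_may[OF F N2] \<open>(a, u') \<in> N2\<close> .
      ultimately show ?thesis by (auto simp: N_eq P_def)
    qed
    then show ?thesis using N1 by auto
  qed
  moreover have "P \<subseteq> dstates D \<times> dstates (dmts_conj E F)"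
    using R Q by (auto simp: dmts_refinement_def P_def)
  ultimately have "dmts_refinement D (dmts_conj E F) P"
    \<comment> \<open>The facts collected above speak of \<open>dmts_conj E F\<close> as a whole;
      removing its simp rules keeps the goals in that form.\<close>
    unfolding dmts_refinement_def by (auto simp: P_def simp del: dmts_conj_simps)
  moreover have "initialised (dinit D) (dinit (dmts_conj E F)) P"
    using R_init Q_init by (fastforce simp: initialised_def P_def)
  ultimately show ?thesis by (auto simp: dmts_le_def)
qed

lemma dmts_le_conj_iff:
  assumes "is_dmts \<Sigma> D" "is_dmts \<Sigma> E" "is_dmts \<Sigma> F"
  shows "dmts_le D (dmts_conj E F) \<longleftrightarrow> dmts_le D E \<and> dmts_le D F"
  using dmts_le_conjD1 dmts_le_conjD2 dmts_le_conjI[OF assms] by blast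

text \<open>Each equation between sets of implementations is the corresponding lower-bound
  equivalence with an embedded LTS on the left; for DMTS, \<open>is_dmts_lts_dmts\<close> supplies
  the well-formedness of that embedding.\<close>

theorem theorem3:
  fixes \<Sigma> :: "'a set"
    and A1 :: "('s1, 'a) naa" and A2 :: "('s2, 'a) naa" and A3 :: "('s3, 'a) naa"
    and D1 :: "('d1, 'a) dmts" and D2 :: "('d2, 'a) dmts" and D3 :: "('d3, 'a) dmts"
  assumes "finite \<Sigma>"
  shows "(is_naa \<Sigma> A1 \<and> is_naa \<Sigma> A2 \<and> is_naa \<Sigma> A3 \<longrightarrow>
            (naa_sem \<Sigma> (naa_conj \<Sigma> A1 A2) :: ('i, 'a) lts set) = naa_sem \<Sigma> A1 \<inter> naa_sem \<Sigma> A2 \<and>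
            (naa_le A1 (naa_conj \<Sigma> A2 A3) \<longleftrightarrow> naa_le A1 A2 \<and> naa_le A1 A3)) \<and>
         (is_dmts \<Sigma> D1 \<and> is_dmts \<Sigma> D2 \<and> is_dmts \<Sigma> D3 \<longrightarrow>
            (dmts_sem \<Sigma> (dmts_conj D1 D2) :: ('i, 'a) lts set) = dmts_sem \<Sigma> D1 \<inter> dmts_sem \<Sigma> D2 \<and>
            (dmts_le D1 (dmts_conj D2 D3) \<longleftrightarrow> dmts_le D1 D2 \<and> dmts_le D1 D3))"
  by (auto simp: naa_sem_def dmts_sem_def naa_le_conj_iff
      dmts_le_conj_iff[OF is_dmts_lts_dmts] dmts_le_conj_iff)

end
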